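(* Let $(L,\le)$ be a linearly ordered set and let $\mathbf{H}$ be a cover of $L$ (possibly with multiplicity) such that $\mathcal{H}\subseteq \mathrm{conv}(L)$. Then $\mathbf{H}$ has a maximally good coloring.
   Context: $\mathrm{conv}(L)$ denotes the family of convex subsets of $L$ (sets $I$ with $x\le z\le y$, $x,y\in I$ implying $z\in I$). Covers with multiplicity: for a set $X$, a family $\mathcal H\subseteq\mathcal P(X)$ and a function $m:\mathcal H\to\mathrm{On}\setminus\{0\}$, the cover on $X$ by $\mathcal H$ with multiplicity $m$ is $\mathbf H=\{\langle H,\alpha\rangle: H\in\mathcal H,\ \alpha<m(H)\}$ (each $H$ is used $m(H)$ times); it is simple if $m\equiv 1$, and then $\mathbf H$ is identified with $\mathcal H$. For $x\in X$, $\mathbf H(x)=\{\langle H,\alpha\rangle\in\mathbf H: x\in H\}$. $\mathbf H$ is a cover of $Y\subseteq X$ if $|\mathbf H(x)|\ge 1$ for all $x\in Y$; "cover" without specifying $Y$ means cover of $\bigcup\mathcal H$. For a partial function $c:\mathbf H\to\mathrm{On}$ write $c[A]=\{c(a):a\in A\cap\mathrm{dom}(c)\}$. A partial function $c:\mathbf H\to\mathrm{On}$ is $\kappa$-good over $Y$ (for a cardinal $\kappa$) if for every $x\in Y$ with $|\mathbf H(x)|\ge\kappa$ we have $\kappa\subseteq c[\mathbf H(x)]$. It is a maximally good coloring of $\mathbf H$ if it is $1$-good and $\lambda$-good for every infinite cardinal $\lambda$, over $\bigcup\mathcal H$. *)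

theory Defs
  imports Main
begin

unbundle cardinal_syntax

(* HOL has no type of all ordinals.  The type 'b ordinal consists of the order types of all
   well-orders on subsets of 'b, that is, of all ordinals of cardinality at most that of 'b.
   It is downward closed, so each of its elements has the right set of predecessors. *)

quotient_type 'b ordinal = "'b rel" / partial: "\<lambda>r s. (r, s) \<in> (ordIso :: ('b rel \<times> 'b rel) set)"
proof (rule part_equivpI)
  show "\<exists>r :: 'b rel. r =o r"
    by (rule exI[of _ "card_of {}"]) (rule ordIso_reflexive[OF card_of_Well_order])
  show "symp (\<lambda>r s :: 'b rel. r =o s)"
    by (auto intro!: sympI dest: ordIso_symmetric)
  show "transp (\<lambda>r s :: 'b rel. r =o s)"
    by (auto intro!: transpI dest: ordIso_transitive)
qed

definition otype :: "'b rel \<Rightarrow> 'b ordinal" where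
  "otype r = abs_ordinal r"

instantiation ordinal :: (type) linorder
begin

lift_definition less_eq_ordinal :: "'a ordinal \<Rightarrow> 'a ordinal \<Rightarrow> bool"
  is "\<lambda>r s. (r, s) \<in> ordLeq"
  by (meson ordIso_iff_ordLeq ordLeq_transitive)

lift_definition less_ordinal :: "'a ordinal \<Rightarrow> 'a ordinal \<Rightarrow> bool"
  is "\<lambda>r s. (r, s) \<in> ordLess"
  by (meson ordIso_ordLess_trans ordIso_symmetric ordLess_ordIso_trans)

instance
proof
  fix x y z :: "'a ordinal"
  show "x < y \<longleftrightarrow> x \<le> y \<and> \<not> y \<le> x"
  proof transfer
    fix r s :: "'a rel"
    assume "r =o r" "s =o s"
    then have "Well_order r" "Well_order s" by (simp_all add: ordIso_def)
    then show "r <o s \<longleftrightarrow> r \<le>o s \<and> (s, r) \<notin> ordLeq"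
      using ordLess_or_ordLeq[of r s] ordLess_imp_ordLeq[of r s] not_ordLess_ordLeq[of r s] by blast
  qed
  show "x \<le> x"
    by transfer (simp add: ordIso_imp_ordLeq)
  show "x \<le> z" if "x \<le> y" "y \<le> z"
    using that by transfer (rule ordLeq_transitive)
  show "x = y" if "x \<le> y" "y \<le> x"
    using that by transfer (simp add: ordIso_iff_ordLeq)
  show "x \<le> y \<or> y \<le> x"
  proof transfer
    fix r s :: "'a rel"
    assume "r =o r" "s =o s"
    then have "Well_order r" "Well_order s" by (simp_all add: ordIso_def)
    then show "r \<le>o s \<or> s \<le>o r" by (rule ordLeq_total)
  qed
qed

end

lemma ordinal_cases:
  obtains r where "Well_order r" "x = otype r"
proof -
  have "(rep_ordinal x, rep_ordinal x) \<in> ordIso"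
    by (rule Quotient3_rep_reflp[OF Quotient3_ordinal])
  then show thesis
    using that[of "rep_ordinal x"] Quotient3_abs_rep[OF Quotient3_ordinal, of x]
    by (auto simp: ordIso_def otype_def)
qed

lemma otype_less_iff:
  "Well_order r \<Longrightarrow> Well_order s \<Longrightarrow> otype r < otype s \<longleftrightarrow> r <o s"
  unfolding otype_def by (rule less_ordinal.abs_eq; rule ordIso_reflexive)

lemma otype_eq_iff:
  "Well_order r \<Longrightarrow> Well_order s \<Longrightarrow> otype r = otype s \<longleftrightarrow> r =o s"
  unfolding otype_def
  using Quotient3_rel[OF Quotient3_ordinal, of r s] ordIso_reflexive[of r] ordIso_reflexive[of s]
  by blast

instance ordinal :: (type) wellorder
proof
  fix P :: "'a ordinal \<Rightarrow> bool" and a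
  assume step: "\<And>x. (\<And>y. y < x \<Longrightarrow> P y) \<Longrightarrow> P x"
  have "Well_order r \<longrightarrow> P (otype r)" for r
  proof (induction r rule: wf_induct[OF wf_ordLess])
    case (1 r)
    show ?case
    proof
      assume r: "Well_order r"
      show "P (otype r)"
      proof (rule step)
        fix y assume "y < otype r"
        then show "P y"
          using 1 r by (metis ordinal_cases otype_less_iff)
      qed
    qed
  qed
  then show "P a" by (metis ordinal_cases)
qed

instantiation ordinal :: (type) zero_neq_one
begin

definition zero_ordinal :: "'a ordinal" where
  "0 = otype (card_of {})"

definition one_ordinal :: "'a ordinal" where
  "1 = otype (card_of {undefined})"

instance
proof
  have "\<not> |{}| =o |{undefined}|"
    by (metis insert_not_empty card_of_empty3 ordIso_iff_ordLeq)
  then show "(0 :: 'a ordinal) \<noteq> 1"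
    unfolding zero_ordinal_def one_ordinal_def by (simp add: otype_eq_iff card_of_Well_order)
qed

end

(* An ordinal has as many predecessors as any well-order of that type has elements,
   and every set of elements of 'b has its cardinality among the initial ordinals in 'b ordinal. *)

lemma card_of_lessThan_otype:
  assumes "Well_order r"
  shows "|{..<otype r}| =o |Field r|"
proof -
  let ?s = "\<lambda>x. Restr r (underS r x)"
  have wo: "Well_order (?s x)" for x
    using assms by (rule Well_order_Restr)
  have lt: "?s x <o ?s y" if "x \<in> Field r" "y \<in> Field r" "x \<noteq> y" "(x, y) \<in> r" for x y
  proof -
    have wr: "wo_rel r" using assms by (simp add: wo_rel_def)
    have "underS r x \<subset> underS r y"
      using that wo_rel.TRANS[OF wr] wo_rel.ANTISYM[OF wr]
      unfolding underS_def trans_def antisym_def by blast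
    then show ?thesis
      using ofilter_subset_ordLess[OF assms wo_rel.underS_ofilter[OF wr] wo_rel.underS_ofilter[OF wr]] by blast
  qed
  have "bij_betw (\<lambda>x. otype (?s x)) (Field r) {..<otype r}"
  proof (rule bij_betw_imageI)
    show "inj_on (\<lambda>x. otype (?s x)) (Field r)"
    proof (rule inj_onI, rule ccontr)
      fix x y assume xy: "x \<in> Field r" "y \<in> Field r" "otype (?s x) = otype (?s y)" "x \<noteq> y"
      have "(x, y) \<in> r \<or> (y, x) \<in> r"
        using assms xy by (auto simp: well_order_on_def linear_order_on_def total_on_def)
      then have "?s x <o ?s y \<or> ?s y <o ?s x"
        using lt xy by blast
      then show False
        using xy(3) by (metis otype_less_iff wo order_less_irrefl)
    qed
    show "(\<lambda>x. otype (?s x)) ` Field r = {..<otype r}"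
    proof (intro equalityI subsetI)
      fix z assume "z \<in> (\<lambda>x. otype (?s x)) ` Field r"
      then obtain x where x: "x \<in> Field r" "z = otype (?s x)" by blast
      then have "?s x <o r"
        using ordLess_iff_ordIso_Restr[OF assms wo] ordIso_reflexive[OF wo] by blast
      then show "z \<in> {..<otype r}"
        using assms wo x by (simp add: otype_less_iff)
    next
      fix z assume "z \<in> {..<otype r}"
      moreover obtain t where t: "Well_order t" "z = otype t" by (rule ordinal_cases)
      ultimately have "t <o r" using assms by (simp add: otype_less_iff)
      then obtain a where "a \<in> Field r" "t =o ?s a"
        using ordLess_iff_ordIso_Restr[OF assms t(1)] by blast
      then show "z \<in> (\<lambda>x. otype (?s x)) ` Field r"
        using t wo by (auto simp: otype_eq_iff)
    qed
  qed
  then have "|Field r| =o |{..<otype r}|"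
    by (rule card_of_ordIsoI)
  then show ?thesis by (rule ordIso_symmetric)
qed

lemma lessThan_one_ordinal: "{..<1 :: 'b ordinal} = {0}"
proof -
  have "|{..<1 :: 'b ordinal}| =o |{undefined :: 'b}|"
    using card_of_lessThan_otype[OF card_of_Well_order, of "{undefined :: 'b}"]
    by (simp add: one_ordinal_def Field_card_of)
  then obtain f where "bij_betw f {..<1 :: 'b ordinal} {undefined :: 'b}"
    using card_of_ordIso by blast
  then have "card {..<1 :: 'b ordinal} = 1"
    by (simp add: bij_betw_same_card)
  then obtain a where a: "{..<1 :: 'b ordinal} = {a}"
    by (rule card_1_singletonE)
  have "|{..<0 :: 'b ordinal}| =o |{} :: 'b set|"
    using card_of_lessThan_otype[OF card_of_Well_order, of "{} :: 'b set"]
    by (simp add: zero_ordinal_def Field_card_of)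
  then have "{..<0 :: 'b ordinal} = {}"
    using card_of_empty3 ordIso_iff_ordLeq by blast
  then have "\<not> 1 < (0 :: 'b ordinal)"
    by auto
  then have "(0 :: 'b ordinal) \<in> {..<1}"
    using zero_neq_one[where 'a = "'b ordinal"] by (simp add: order.strict_iff_order not_less)
  then show ?thesis using a by simp
qed

definition is_cardinal :: "'b ordinal \<Rightarrow> bool" where
  "is_cardinal \<kappa> \<longleftrightarrow> (\<forall>\<beta><\<kappa>. |{..<\<beta>}| <o |{..<\<kappa>}| )"

lemma ex_cardinal:
  fixes A :: "'b set"
  shows "\<exists>\<kappa> :: 'b ordinal. is_cardinal \<kappa> \<and> |{..<\<kappa>}| =o |A|"
proof (intro exI conjI)
  have A: "Well_order |A|" by (rule card_of_Well_order)
  show *: "|{..<otype |A| }| =o |A|"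
    using card_of_lessThan_otype[OF A] by (simp add: Field_card_of)
  show "is_cardinal (otype |A| )"
    unfolding is_cardinal_def
  proof (intro allI impI)
    fix \<beta> assume "\<beta> < otype |A|"
    moreover obtain s where s: "Well_order s" "\<beta> = otype s" by (rule ordinal_cases)
    ultimately have "s <o |A|" using A by (simp add: otype_less_iff)
    then have "|Field s| <o |A|"
      using card_of_least[of "Field s" s] s by (blast intro: ordLeq_ordLess_trans)
    then show "|{..<\<beta>}| <o |{..<otype |A| }|"
      using card_of_lessThan_otype[OF s(1)] * s(2)
      by (metis ordIso_ordLess_trans ordIso_symmetric ordLess_ordIso_trans)
  qed
qed

definition conv :: "'a set \<Rightarrow> 'a rel \<Rightarrow> 'a set set" where
  "conv L r = {I. I \<subseteq> L \<and>
     (\<forall>x\<in>I. \<forall>y\<in>I. \<forall>z\<in>L. (x, z) \<in> r \<and> (z, y) \<in> r \<longrightarrow> z \<in> I)}"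

(* The multiplicity m takes values in 'o ordinal for an arbitrary type 'o.  As only set-many
   values of m occur, every multiplicity function into the ordinals has this form for some 'o. *)

definition multicover ::
  "'a set set \<Rightarrow> ('a set \<Rightarrow> 'o ordinal) \<Rightarrow> ('a set \<times> 'o ordinal) set" where
  "multicover \<H> m = {(H, \<alpha>). H \<in> \<H> \<and> \<alpha> < m H}"

definition at_point :: "('a set \<times> 'o) set \<Rightarrow> 'a \<Rightarrow> ('a set \<times> 'o) set" where
  "at_point B x = {(H, \<alpha>) \<in> B. x \<in> H}"

definition covers :: "('a set \<times> 'o) set \<Rightarrow> 'a set \<Rightarrow> bool" where
  "covers B Y \<longleftrightarrow> (\<forall>x\<in>Y. at_point B x \<noteq> {})"

definition colors :: "('b \<rightharpoonup> 'c) \<Rightarrow> 'b set \<Rightarrow> 'c set" where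
  "colors c A = {the (c a) | a. a \<in> A \<inter> dom c}"

(* An ordinal is the set of its predecessors, so kappa is rendered as {..<kappa}. *)

definition good ::
  "'c ordinal \<Rightarrow> 'a set \<Rightarrow> ('a set \<times> 'o) set \<Rightarrow> ('a set \<times> 'o \<rightharpoonup> 'c ordinal) \<Rightarrow> bool" where
  "good \<kappa> Y B c \<longleftrightarrow>
     (\<forall>x\<in>Y. |{..<\<kappa>}| \<le>o |at_point B x| \<longrightarrow> {..<\<kappa>} \<subseteq> colors c (at_point B x))"

(* The colours are ordinals of cardinality at most that of the type of pairs (H, alpha).  This
   loses nothing: by ex_cardinal the cardinality of every subset of the cover is among them, so a
   cardinal not represented here exceeds |at_point B x| for every x, which makes goodness for it
   vacuous, and a colour outside this type never helps to meet the other requirements. *)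

definition maximally_good_coloring ::
  "'a set set \<Rightarrow> ('a set \<Rightarrow> 'o ordinal) \<Rightarrow>
     ('a set \<times> 'o ordinal \<rightharpoonup> ('a set \<times> 'o ordinal) ordinal) \<Rightarrow> bool" where
  "maximally_good_coloring \<H> m c \<longleftrightarrow>
     dom c \<subseteq> multicover \<H> m \<and>
     good 1 (\<Union>\<H>) (multicover \<H> m) c \<and>
     (\<forall>\<kappa>. is_cardinal \<kappa> \<and> infinite {..<\<kappa>} \<longrightarrow> good \<kappa> (\<Union>\<H>) (multicover \<H> m) c)"

end

theory Submission
  imports Defs "HOL-Library.Product_Lexorder"
begin

text \<open>
  Remove from a cover, transfinitely often, a subcover \<open>S\<^sub>\<xi>\<close> that has a good colouring of its own, and
  use \<open>\<xi>\<close> as an extra colour on \<open>S\<^sub>\<xi>\<close>; together the stages give a maximally good colouring.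
  A cover by convex sets has such a subcover: in each component (points joined by segments that
  finitely many members cover), each side of a base point is covered by a point-finite family or
  by one together with sets sharing a point.  In a family of sets sharing a point \<open>q\<close>, the subfamilies
  containing a given point form two chains, one for each side of \<open>q\<close>, and such families are coloured
  by the same peeling.
\<close>

text \<open>With the lexicographic order this makes \<open>'b ordinal \<times> bool\<close> a
  well-ordered type of colours, whose bit later splits a set into two halves.\<close>

instance bool :: wellorder
proof
  fix P :: "bool \<Rightarrow> bool" and b
  assume "\<And>x. (\<And>y. y < x \<Longrightarrow> P y) \<Longrightarrow> P x"
  then have "P False" "P True"
    by (metis less_bool_def)+
  then show "P b"
    by (cases b) auto
qed

section \<open>Polychromatic colourings\<close>

text \<open>
  The colours that a point covered by the members of \<open>X\<close> has to see.  If \<open>X\<close> is infinite, these include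
  all colours below every cardinal \<open>\<kappa> \<le> |X|\<close>.
\<close>

definition required :: "'b set \<Rightarrow> 'k::wellorder set" where
  "required X = {a. |{..<a}| <o |X| \<and> (infinite X \<or> {..<a} = {})}"

text \<open>The view is dual: the coloured elements are the members of a cover, and \<open>X\<close>
  will be the set of members that contain a given point.\<close>

definition polychromatic :: "'b set set \<Rightarrow> 'b set \<Rightarrow> ('b \<Rightarrow> 'k::wellorder) \<Rightarrow> bool" where
  "polychromatic \<X> A c \<longleftrightarrow> (\<forall>X\<in>\<X>. required (X \<inter> A) \<subseteq> c ` (X \<inter> A))"

lemma polychromaticD:
  "polychromatic \<X> A c \<Longrightarrow> X \<in> \<X> \<Longrightarrow> required (X \<inter> A) \<subseteq> c ` (X \<inter> A)"
  by (simp add: polychromatic_def)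

definition hits :: "'b set \<Rightarrow> 'b set set \<Rightarrow> 'b set \<Rightarrow> bool" where
  "hits S \<X> B \<longleftrightarrow> (\<forall>X\<in>\<X>. X \<inter> B \<noteq> {} \<longrightarrow> X \<inter> S \<noteq> {})"

definition least :: "'k::wellorder" where
  "least = (LEAST a. True)"

lemma lessThan_least [simp]: "{..<least :: 'k::wellorder} = {}"
  by (auto simp: least_def dest: not_less_Least)

lemma lessThan_empty_iff [simp]: "{..<a :: 'k::wellorder} = {} \<longleftrightarrow> a = least"
  by (metis Least_le TrueI least_def lessThan_iff empty_iff lessThan_least order_le_less)

lemma card_of_pos: "|{} :: 'a set| <o |X| \<longleftrightarrow> X \<noteq> {}"
  by (auto simp: card_of_ordLess[symmetric])

lemma least_in_required: "X \<noteq> {} \<Longrightarrow> least \<in> required X"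
  unfolding required_def by (simp add: card_of_pos)

lemma required_finite: "finite X \<Longrightarrow> required X = (if X = {} then {} else {least})"
  by (auto simp: required_def card_of_pos)

lemma required_mono: "|X| \<le>o |Y| \<Longrightarrow> required X \<subseteq> required Y"
  unfolding required_def
  using card_of_ordLeq_infinite by (auto intro: ordLess_ordLeq_trans)

lemma required_infinite: "infinite X \<Longrightarrow> required X = {a. |{..<a}| <o |X|}"
  by (simp add: required_def)

text \<open>\<open>required D\<close> is well-ordered and its proper initial segments are smaller
  than \<open>D\<close>. If it were larger than \<open>D\<close>, one of these segments would be
  equinumerous with \<open>D\<close>.\<close>

lemma card_of_required:
  assumes "infinite D"
  shows "|required D :: 'k::wellorder set| \<le>o |D|"
proof (rule ccontr)
  let ?T = "required D :: 'k set"
  let ?r = "{(x, y). x \<in> ?T \<and> y \<in> ?T \<and> x \<le> y}"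
  assume "\<not> |?T| \<le>o |D|"
  then have lt: "|D| <o |?T|"
    by (simp add: not_ordLeq_iff_ordLess card_of_Well_order)
  have fld: "Field ?r = ?T"
    by (auto simp: Field_def)
  have "wf (?r - Id)"
    by (rule wf_subset[OF wf]) auto
  then have wo: "Well_order ?r"
    unfolding well_order_on_def linear_order_on_def partial_order_on_def preorder_on_def fld
    by (intro conjI refl_onI transI antisymI total_onI) auto
  have "|?T| \<le>o ?r"
    by (rule card_of_least) (use wo in \<open>simp only: fld\<close>)
  then have "|D| <o ?r"
    by (rule ordLess_ordLeq_trans[OF lt])
  then obtain a where a: "a \<in> Field ?r" "|D| =o Restr ?r (underS ?r a)"
    unfolding ordLess_iff_ordIso_Restr[OF wo card_of_Well_order] by (rule bexE)
  have "Field (Restr ?r (underS ?r a)) \<subseteq> {..<a}"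
    by (auto simp: Field_def underS_def)
  moreover have "|D| =o |Field (Restr ?r (underS ?r a))|"
    using card_of_cong[OF a(2)] by (simp only: Field_card_of)
  ultimately have "|D| \<le>o |{..<a}|"
    by (intro ordIso_ordLeq_trans[OF _ card_of_mono1])
  moreover have "|{..<a}| <o |D|"
    using a(1) assms unfolding fld by (simp add: required_infinite)
  ultimately show False
    using not_ordLess_ordLeq by blast
qed

lemma hits_self: "hits B \<X> B"
  by (simp add: hits_def)

lemma polychromatic_pointwise_finite:
  assumes "\<And>X. X \<in> \<X> \<Longrightarrow> finite (X \<inter> S)"
  shows "polychromatic \<X> S (\<lambda>_. least)"
  using assms by (auto simp: polychromatic_def required_finite split: if_splits)

lemma required_Un:
  fixes X Y :: "'b set"
  shows "required (X \<union> Y) \<subseteq> required X \<union> required Y"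
proof (cases "finite X \<and> finite Y")
  case True
  then show ?thesis
    by (auto simp: required_finite split: if_splits)
next
  case False
  have le: "|X| \<le>o |Y| \<or> |Y| \<le>o |X|"
    by (rule ordLeq_total) (rule card_of_Well_order)+
  have "required (U \<union> V) \<subseteq> required V" if "|U| \<le>o |V|" "infinite U \<or> infinite V" for U V :: "'b set"
  proof (rule required_mono)
    have "infinite V"
      using that card_of_ordLeq_infinite by blast
    then show "|U \<union> V| \<le>o |V|"
      using card_of_Un_ordLeq_infinite_Field[of "|V|" U V] that(1)
        card_of_refl[THEN ordIso_imp_ordLeq, of V] card_of_Card_order[of V] by (simp add: Field_card_of)
  qed
  from this[of X Y] this[of Y X] le False show ?thesis
    by (auto simp: Un_commute)
qed

lemma polychromatic_Un:
  fixes c d :: "'b \<Rightarrow> 'k::wellorder"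
  assumes c: "polychromatic \<X> A c" and d: "polychromatic \<X> B d" and "A \<inter> B = {}"
  shows "polychromatic \<X> (A \<union> B) (\<lambda>b. if b \<in> A then c b else d b)"
  unfolding polychromatic_def
proof (intro ballI subsetI)
  fix X and a :: 'k assume X: "X \<in> \<X>" and "a \<in> required (X \<inter> (A \<union> B))"
  then have "a \<in> required (X \<inter> A) \<union> required (X \<inter> B)"
    using required_Un[of "X \<inter> A" "X \<inter> B"] by (auto simp: Int_Un_distrib)
  then have "a \<in> c ` (X \<inter> A) \<or> a \<in> d ` (X \<inter> B)"
    using c d X by (auto simp: polychromatic_def)
  then show "a \<in> (\<lambda>b. if b \<in> A then c b else d b) ` (X \<inter> (A \<union> B))"
    using assms(3) by (auto simp: image_iff)
qed

text \<open>For \<open>\<pi>\<close> sending each member to its component: no point lies in members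
  from different components, so these can be coloured independently.\<close>

lemma polychromatic_glue:
  assumes "\<And>p. polychromatic \<X> {b \<in> G. \<pi> b = p} (c p)"
    and "\<And>X. X \<in> \<X> \<Longrightarrow> \<exists>p. \<forall>b\<in>X \<inter> G. \<pi> b = p"
  shows "polychromatic \<X> G (\<lambda>b. c (\<pi> b) b)"
  unfolding polychromatic_def
proof
  fix X assume X: "X \<in> \<X>"
  obtain p where p: "\<forall>b\<in>X \<inter> G. \<pi> b = p"
    using assms(2)[OF X] by blast
  then have "X \<inter> {b \<in> G. \<pi> b = p} = X \<inter> G"
    by auto
  then have "required (X \<inter> G) \<subseteq> c p ` (X \<inter> G)"
    using assms(1)[of p] X unfolding polychromatic_def by fastforce
  then show "required (X \<inter> G) \<subseteq> (\<lambda>b. c (\<pi> b) b) ` (X \<inter> G)"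
    using p by (metis (mono_tags, lifting) image_cong)
qed

text \<open>
  Peel off hitting sets transfinitely and give the stage \<open>\<xi>\<close> its own colouring with the least
  colour replaced by \<open>\<xi>\<close>.  If \<open>X\<close> meets stage \<open>a\<close>, it sees \<open>a\<close> there.  Otherwise \<open>X\<close> is exhausted
  by fewer than \<open>|X|\<close> stages, so some earlier stage already meets \<open>X\<close> in a set large enough for \<open>a\<close>
  to be required there.
\<close>

lemma polychromatic_transfinite:
  fixes \<X> :: "'b set set"
  assumes step: "\<And>A. A \<subseteq> B \<Longrightarrow>
    \<exists>S\<subseteq>A. hits S \<X> A \<and> (\<exists>c :: 'b \<Rightarrow> 'k::wellorder. polychromatic \<X> S c)"
  shows "\<exists>c :: 'b \<Rightarrow> 'k. polychromatic \<X> B c"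
proof -
  obtain S and c :: "'b set \<Rightarrow> 'b \<Rightarrow> 'k"
    where S: "\<And>A. A \<subseteq> B \<Longrightarrow> S A \<subseteq> A" "\<And>A. A \<subseteq> B \<Longrightarrow> hits (S A) \<X> A"
      and c: "\<And>A. A \<subseteq> B \<Longrightarrow> polychromatic \<X> (S A) (c A)"
    using step by metis
  define W :: "('k \<times> 'k) set" where "W = {(x, y). x < y}"
  \<comment> \<open>\<open>R a\<close> is what the stages before \<open>a\<close> leave over; stage
    \<open>a\<close> removes \<open>S (R a)\<close>.\<close>
  define R where "R = wfrec W (\<lambda>f a. B - (\<Union>\<xi>\<in>{..<a}. S (f \<xi>)))"
  have R: "R a = B - (\<Union>\<xi>\<in>{..<a}. S (R \<xi>))" for a
  proof -
    have "R a = B - (\<Union>\<xi>\<in>{..<a}. S (cut R W a \<xi>))"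
      unfolding R_def by (rule wfrec) (simp add: W_def wf)
    then show ?thesis
      by (simp add: cut_apply W_def)
  qed
  have RB: "R a \<subseteq> B" for a
    using R[of a] by blast
  have disj: "b \<notin> S (R \<zeta>)" if "b \<in> S (R \<xi>)" "\<xi> < \<zeta>" for b \<xi> \<zeta>
    using that S(1)[OF RB] R[of \<zeta>] by blast
  then have uniq: "(SOME \<zeta>. b \<in> S (R \<zeta>)) = \<xi>" if "b \<in> S (R \<xi>)" for b \<xi>
    using that by (metis someI linorder_neqE)
  \<comment> \<open>An element that no stage removes gets an arbitrary colour. This is harmless,
    since additional colours never spoil \<open>polychromatic\<close>.\<close>
  define d where "d b = (let \<xi> = SOME \<zeta>. b \<in> S (R \<zeta>) in
    if c (R \<xi>) b = least then \<xi> else c (R \<xi>) b)" for b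
  have d: "d b = (if c (R \<xi>) b = least then \<xi> else c (R \<xi>) b)" if "b \<in> S (R \<xi>)" for b \<xi>
    unfolding d_def uniq[OF that] by (simp add: Let_def)
  have "polychromatic \<X> B d"
    unfolding polychromatic_def
  proof (intro ballI subsetI)
    fix X and a :: 'k assume X: "X \<in> \<X>" and a: "a \<in> required (X \<inter> B)"
    have SB: "S (R \<xi>) \<subseteq> B" for \<xi>
      using S(1)[OF RB] RB by blast
    show "a \<in> d ` (X \<inter> B)"
    proof (cases "X \<inter> S (R a) = {}")
      case False
      then have "least \<in> c (R a) ` (X \<inter> S (R a))"
        by (rule polychromaticD[OF c[OF RB] X, THEN subsetD, OF least_in_required])
      then obtain b where "b \<in> X \<inter> S (R a)" "c (R a) b = least"
        by auto
      moreover from this have "d b = a"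
        using d[of b a] by simp
      ultimately show ?thesis
        using SB by blast
    next
      case True
      \<comment> \<open>Stage \<open>a\<close> hits every \<open>X\<close> that meets
        \<open>R a\<close>, so missing \<open>X\<close> means that nothing of \<open>X\<close> was
        left.\<close>
      then have "X \<inter> R a = {}"
        using S(2)[OF RB] X unfolding hits_def by metis
      then have "X \<inter> (B - (\<Union>\<xi>\<in>{..<a}. S (R \<xi>))) = {}"
        by (simp only: R[of a, symmetric])
      then have XB: "X \<inter> B = (\<Union>\<xi>\<in>{..<a}. X \<inter> S (R \<xi>))"
        using SB by blast
      have "\<exists>\<xi><a. a \<in> required (X \<inter> S (R \<xi>))"
      proof (rule ccontr)
        assume neg: "\<not> ?thesis"
        have ne: "X \<inter> B \<noteq> {}"
          using a by (auto simp: required_finite)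
        then have "a \<noteq> least"
          using XB by (metis lessThan_least UN_empty)
        then have inf: "infinite (X \<inter> B)" and lt: "|{..<a}| <o |X \<inter> B|"
          using a by (auto simp: required_def)
        have small: "finite (X \<inter> S (R \<xi>)) \<or> |X \<inter> S (R \<xi>)| \<le>o |{..<a}|" if "\<xi> < a" for \<xi>
        proof (rule ccontr)
          assume "\<not> ?thesis"
          then have "a \<in> required (X \<inter> S (R \<xi>))"
            by (simp add: required_infinite not_ordLeq_iff_ordLess card_of_Well_order)
          then show False
            using neg that by simp
        qed
        show False
        \<comment> \<open>\<open>X \<inter> B\<close> has one piece per stage below
          \<open>a\<close>: finitely many finite pieces, or else pieces of size at most
          \<open>|{..<a}|\<close>. Either way it is too small.\<close>
        proof (cases "finite {..<a}")
          case True
          then have "finite (X \<inter> S (R \<xi>))" if "\<xi> < a" for \<xi>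
            using small[OF that] card_of_ordLeq_finite[of "X \<inter> S (R \<xi>)" "{..<a}"] by metis
          then have "finite (X \<inter> B)"
            unfolding XB using True by (intro finite_UN_I) auto
          then show False
            using inf by simp
        next
          case False
          then have "finite Z \<Longrightarrow> |Z| \<le>o |{..<a}|" for Z :: "'b set"
            by (intro ordLess_imp_ordLeq finite_ordLess_infinite card_of_Well_order)
              (simp_all add: Field_card_of)
          then have "|X \<inter> S (R \<xi>)| \<le>o |{..<a}|" if "\<xi> < a" for \<xi>
            using small[OF that] by metis
          then have "|X \<inter> B| \<le>o |{..<a}|"
            unfolding XB by (intro card_of_UNION_ordLeq_infinite False) (auto intro: ordIso_imp_ordLeq card_of_refl)
          then show False
            using lt not_ordLess_ordLeq by blast
        qed
      qed
      then obtain \<xi> where \<xi>: "\<xi> < a" "a \<in> required (X \<inter> S (R \<xi>))"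
        by blast
      then have "a \<in> c (R \<xi>) ` (X \<inter> S (R \<xi>))"
        by (intro polychromaticD[OF c[OF RB] X, THEN subsetD])
      then obtain b where b: "b \<in> X \<inter> S (R \<xi>)" "c (R \<xi>) b = a"
        by auto
      \<comment> \<open>Only the colour \<open>least\<close> was overwritten, so \<open>d\<close>
        keeps the colour \<open>a\<close> at \<open>b\<close>.\<close>
      moreover have "a \<noteq> least"
        using \<xi>(1) by (metis lessThan_iff empty_iff lessThan_least)
      ultimately have "d b = a"
        using d[of b \<xi>] by simp
      then show ?thesis
        using b(1) SB by blast
    qed
  qed
  then show ?thesis
    by blast
qed

section \<open>Families whose traces form one or two chains\<close>

text \<open>
  Take \<open>D\<close> of minimal cardinality among the hitting sets, well-order it by its cardinal, and keep
  the elements that lie in a member of the chain containing no earlier element.  The kept elements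
  outside \<open>U\<close> all precede the first element of \<open>D \<inter> U\<close>.
\<close>

lemma chain_hitting_set:
  assumes chain: "chain\<^sub>\<subseteq> \<U>"
  obtains D where "D \<subseteq> B" "hits D \<U> B"
    "\<And>U. U \<in> \<U> \<Longrightarrow> U \<inter> B \<noteq> {} \<Longrightarrow> |D - U| <o |D|"
proof -
  let ?H = "{D. D \<subseteq> B \<and> hits D \<U> B}"
  have "card_of ` ?H \<noteq> {}"
    using hits_self by blast
  then obtain D where D: "D \<subseteq> B" "hits D \<U> B" and min: "\<And>E. E \<in> ?H \<Longrightarrow> |D| \<le>o |E|"
    using exists_minim_Well_order[of "card_of ` ?H"] card_of_Well_order by auto
  let ?r = "|D|"
  define D' where "D' = {d \<in> D. \<exists>U\<in>\<U>. d \<in> U \<and> (\<forall>e\<in>underS ?r d. e \<notin> U)}"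
  have wf: "wf (?r - Id)"
    using card_of_Well_order[of D] by (simp add: well_order_on_def)
  have first: "\<exists>k\<in>D \<inter> U. \<forall>e\<in>underS ?r k. e \<notin> U" if U: "U \<in> \<U>" "U \<inter> B \<noteq> {}" for U
  proof -
    have "D \<inter> U \<noteq> {}"
      using D(2) U unfolding hits_def by blast
    then obtain k where k: "k \<in> D \<inter> U" "\<And>e. (e, k) \<in> ?r - Id \<Longrightarrow> e \<notin> D \<inter> U"
      using wfE_min[OF wf] by (metis ex_in_conv)
    have "e \<notin> U" if "e \<in> underS ?r k" for e
    proof -
      have "(e, k) \<in> ?r" "e \<noteq> k"
        using that by (auto simp: underS_def)
      moreover from this have "e \<in> D"
        using Field_card_of[of D] by (auto simp: Field_def)
      ultimately show ?thesis
        using k(2) by blast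
    qed
    then show ?thesis
      using k(1) by blast
  qed
  have D'B: "D' \<subseteq> B"
    using D(1) by (auto simp: D'_def)
  have hit: "hits D' \<U> B"
    unfolding hits_def
  proof (intro ballI impI)
    fix U assume U: "U \<in> \<U>" "U \<inter> B \<noteq> {}"
    then show "U \<inter> D' \<noteq> {}"
      using first[OF U] unfolding D'_def by blast
  qed
  have small: "|D' - U| <o |D'|" if U: "U \<in> \<U>" "U \<inter> B \<noteq> {}" for U
  proof -
    obtain k where k: "k \<in> D" "k \<in> U"
      using first[OF U] by blast
    \<comment> \<open>Each such \<open>d\<close> was kept because of some \<open>V\<close> without
      earlier elements. As \<open>d\<close> lies outside \<open>U\<close>, the chain gives
      \<open>U \<subseteq> V\<close>, so \<open>k\<close> is in \<open>V\<close> and cannot precede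
      \<open>d\<close>.\<close>
    have "D' - U \<subseteq> underS ?r k"
    proof
      fix d assume d: "d \<in> D' - U"
      then obtain V where V: "V \<in> \<U>" "d \<in> V" "\<forall>e\<in>underS ?r d. e \<notin> V" and dD: "d \<in> D"
        by (auto simp: D'_def)
      have "V \<subseteq> U \<or> U \<subseteq> V"
        using chain V(1) U(1) by (auto simp: chain_subset_def)
      then have "k \<in> V"
        using V(2) d k(2) by blast
      then have "k \<notin> underS ?r d"
        using V(3) by blast
      moreover have "(k, d) \<in> ?r \<or> (d, k) \<in> ?r" and "d \<noteq> k"
        using card_of_Well_order[of D] k d dD
        by (auto simp: well_order_on_def linear_order_on_def total_on_def Field_card_of)
      ultimately show "d \<in> underS ?r k"
        by (auto simp: underS_def)
    qed
    then have "|D' - U| \<le>o |underS ?r k|"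
      by (rule card_of_mono1)
    also have "|underS ?r k| <o |D|"
      using card_of_underS[OF card_of_Card_order, of k D] k by (simp add: Field_card_of)
    also have "|D| \<le>o |D'|"
      using min hit D'B by simp
    finally show ?thesis .
  qed
  show thesis
    using that D'B hit small by blast
qed

text \<open>Map \<open>D\<close> onto \<open>required D \<times> D\<close> and colour by the first
  coordinate. Each colour class has \<open>|D|\<close> elements, too many to lie inside the small
  set \<open>D - Z\<close>.\<close>

lemma polychromatic_cosmall:
  assumes inf: "infinite D"
  obtains c :: "'b \<Rightarrow> 'k::wellorder"
  where "\<And>Z. |D - Z| <o |D| \<Longrightarrow> required D \<subseteq> c ` (D \<inter> Z)"
proof -
  have ne: "required D \<times> D \<noteq> ({} :: ('k \<times> 'b) set)"
    using inf least_in_required[of D] by auto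
  have "|required D \<times> D :: ('k \<times> 'b) set| \<le>o |D|"
    using card_of_Times_ordLeq_infinite_Field[of "|D|" "required D :: 'k set" D] inf
      card_of_required[OF inf] ordIso_imp_ordLeq[OF card_of_refl[of D]] card_of_Card_order[of D]
    by (simp add: Field_card_of)
  then obtain g :: "'b \<Rightarrow> 'k \<times> 'b" where g: "g ` D = required D \<times> D"
    unfolding card_of_ordLeq2[OF ne, symmetric] by (rule exE)
  have "required D \<subseteq> (fst \<circ> g) ` (D \<inter> Z)" if Z: "|D - Z| <o |D|" for Z
  proof (rule ccontr)
    assume "\<not> ?thesis"
    then obtain a where a: "a \<in> required D" "a \<notin> (fst \<circ> g) ` (D \<inter> Z)"
      by blast
    have "D \<subseteq> (snd \<circ> g) ` (D - Z)"
    proof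
      fix d assume "d \<in> D"
      then have "(a, d) \<in> g ` D"
        using a(1) g by blast
      then obtain x where x: "x \<in> D" "g x = (a, d)"
        by auto
      then have "x \<notin> Z"
        using a(2) by force
      then show "d \<in> (snd \<circ> g) ` (D - Z)"
        using x by force
    qed
    then have "|D| \<le>o |D - Z|"
      by (meson card_of_image card_of_mono1 ordLeq_transitive)
    then show False
      using Z not_ordLess_ordLeq by blast
  qed
  then show thesis
    using that by blast
qed

text \<open>A stage is the set \<open>D\<close> from \<open>chain_hitting_set\<close>. If it is
  infinite, every member of the chain that meets \<open>A\<close> misses fewer than
  \<open>|D|\<close> of its elements, so one colouring from \<open>polychromatic_cosmall\<close>
  suits them all.\<close>

lemma polychromatic_chain:
  fixes \<U> :: "'b set set"
  assumes chain: "chain\<^sub>\<subseteq> \<U>"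
  shows "\<exists>c :: 'b \<Rightarrow> 'k::wellorder. polychromatic \<U> B c"
proof (rule polychromatic_transfinite)
  fix A
  obtain D where D: "D \<subseteq> A" "hits D \<U> A"
    and small: "\<And>U. U \<in> \<U> \<Longrightarrow> U \<inter> A \<noteq> {} \<Longrightarrow> |D - U| <o |D|"
    using chain_hitting_set[OF chain] by blast
  have "\<exists>c :: 'b \<Rightarrow> 'k. polychromatic \<U> D c"
  proof (cases "finite D")
    case True
    then show ?thesis
      by (intro exI[of _ "\<lambda>_. least"] polychromatic_pointwise_finite) simp
  next
    case False
    then obtain c :: "'b \<Rightarrow> 'k" where c: "\<And>Z. |D - Z| <o |D| \<Longrightarrow> required D \<subseteq> c ` (D \<inter> Z)"
      using polychromatic_cosmall by blast
    have "required (U \<inter> D) \<subseteq> c ` (U \<inter> D)" if U: "U \<in> \<U>" for U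
    proof (cases "U \<inter> D = {}")
      case True
      then show ?thesis
        by (simp add: required_finite)
    next
      case False
      then have "required D \<subseteq> c ` (D \<inter> U)"
        using D(1) by (intro c small U) blast
      moreover have "required (U \<inter> D) \<subseteq> (required D :: 'k set)"
        by (intro required_mono card_of_mono1) simp
      ultimately show ?thesis
        by (simp add: Int_commute)
    qed
    then show ?thesis
      unfolding polychromatic_def by blast
  qed
  then show "\<exists>S\<subseteq>A. hits S \<U> A \<and> (\<exists>c :: 'b \<Rightarrow> 'k. polychromatic \<U> S c)"
    using D by blast
qed

text \<open>The bit of the colour tells the halves apart. An infinite \<open>X \<inter> A\<close>
  sees all pairs \<open>(a, i)\<close> with \<open>a\<close> below its cardinal, which yields that
  many elements for each bit.\<close>

lemma split_polychromatic:
  fixes c :: "'b \<Rightarrow> 'b ordinal \<times> bool"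
  assumes c: "polychromatic \<X> A c"
  obtains P Q where "P \<union> Q = A" "P \<inter> Q = {}"
    and "\<And>X. X \<in> \<X> \<Longrightarrow> infinite (X \<inter> A) \<Longrightarrow> |X \<inter> A| \<le>o |X \<inter> P| \<and> |X \<inter> A| \<le>o |X \<inter> Q|"
    and "hits P \<X> A"
proof -
  define part where "part i = {b \<in> A. snd (c b) = i}" for i
  have big: "|X \<inter> A| \<le>o |X \<inter> part i|" if X: "X \<in> \<X>" and inf: "infinite (X \<inter> A)" for X i
  proof -
    obtain \<kappa> :: "'b ordinal" where \<kappa>: "is_cardinal \<kappa>" "|{..<\<kappa>}| =o |X \<inter> A|"
      using ex_cardinal by blast
    have "{..<\<kappa>} \<subseteq> (fst \<circ> c) ` (X \<inter> part i)"
    proof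
      fix a assume "a \<in> {..<\<kappa>}"
      then have lt: "|{..<a}| <o |X \<inter> A|"
        using \<kappa> unfolding is_cardinal_def by (auto intro: ordLess_ordIso_trans)
      \<comment> \<open>A bound for the lexicographic predecessors of \<open>(a, i)\<close>: two
        copies of \<open>{..<a}\<close> and possibly \<open>(a, False)\<close>.\<close>
      let ?W = "((\<lambda>x. (x, False)) ` {..<a} \<union> (\<lambda>x. (x, True)) ` {..<a}) \<union> {(a, False)}"
      have "{..<(a, i)} \<subseteq> ?W"
        by (auto simp: image_iff)
      then have "|{..<(a, i)}| \<le>o |?W|"
        by (rule card_of_mono1)
      also have "|?W| <o |X \<inter> A|"
      proof (intro card_of_Un_ordLess_infinite inf)
        show "|(\<lambda>x. (x, False)) ` {..<a}| <o |X \<inter> A|" "|(\<lambda>x. (x, True)) ` {..<a}| <o |X \<inter> A|"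
          by (rule ordLeq_ordLess_trans[OF card_of_image lt])+
        show "|{(a, False)}| <o |X \<inter> A|"
          using inf by (intro finite_ordLess_infinite card_of_Well_order) (simp_all add: Field_card_of)
      qed
      finally have "(a, i) \<in> required (X \<inter> A)"
        using inf by (simp add: required_infinite)
      then have "(a, i) \<in> c ` (X \<inter> A)"
        by (rule polychromaticD[OF c X, THEN subsetD])
      then obtain b where b: "b \<in> X \<inter> A" "c b = (a, i)"
        by auto
      then have "b \<in> X \<inter> part i"
        by (simp add: part_def)
      then show "a \<in> (fst \<circ> c) ` (X \<inter> part i)"
        using b(2) by (intro image_eqI[of _ _ b]) simp_all
    qed
    then have "|{..<\<kappa>}| \<le>o |X \<inter> part i|"
      by (meson card_of_image card_of_mono1 ordLeq_transitive)
    then show ?thesis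
      using \<kappa>(2) by (meson ordIso_ordLeq_trans ordIso_symmetric)
  qed
  \<comment> \<open>The least pair has bit \<open>False\<close>, so \<open>part False\<close> also
    meets those \<open>X\<close> for which \<open>X \<inter> A\<close> is finite and
    nonempty.\<close>
  have least: "least = (least :: 'b ordinal, False)"
  proof -
    have "(least :: 'b ordinal, False) \<le> x" for x
      by (cases x) (simp add: Least_le least_def le_less[symmetric])
    then show ?thesis
      unfolding least_def[where 'k = "'b ordinal \<times> bool"] by (intro Least_equality) auto
  qed
  have "hits (part False) \<X> A"
    unfolding hits_def
  proof (intro ballI impI)
    fix X assume X: "X \<in> \<X>" "X \<inter> A \<noteq> {}"
    have "least \<in> c ` (X \<inter> A)"
      using least_in_required[OF X(2)] by (rule polychromaticD[OF c X(1), THEN subsetD])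
    then obtain b where b: "b \<in> X \<inter> A" "c b = (least, False)"
      unfolding least by auto
    then have "b \<in> X \<inter> part False"
      by (simp add: part_def)
    then show "X \<inter> part False \<noteq> {}"
      by blast
  qed
  moreover have "part False \<union> part True = A" "part False \<inter> part True = {}"
    by (auto simp: part_def)
  ultimately show thesis
    using that big by blast
qed

text \<open>
  The two halves into which \<open>D\<close> is split serve one chain each; \<open>UNIV\<close> is added to the second chain
  to make both halves as large as \<open>D\<close>.
\<close>

lemma two_chains_hitting_set:
  fixes \<U> \<V> :: "'b set set"
  assumes U: "chain\<^sub>\<subseteq> \<U>" and V: "chain\<^sub>\<subseteq> \<V>"
  obtains D and c :: "'b \<Rightarrow> 'k::wellorder"
  where "D \<subseteq> A" "hits D \<U> A" "polychromatic (\<U> \<union> \<V>) D c"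
proof -
  obtain D where D: "D \<subseteq> A" "hits D \<U> A"
    and small: "\<And>U. U \<in> \<U> \<Longrightarrow> U \<inter> A \<noteq> {} \<Longrightarrow> |D - U| <o |D|"
    using chain_hitting_set[OF U] by blast
  have "\<exists>c :: 'b \<Rightarrow> 'k. polychromatic (\<U> \<union> \<V>) D c"
  proof (cases "finite D")
    case True
    then show ?thesis
      by (intro exI[of _ "\<lambda>_. least"] polychromatic_pointwise_finite) simp
  next
    case False
    have "chain\<^sub>\<subseteq> (insert UNIV \<V>)"
      using V by (auto simp: chain_subset_def)
    then obtain c0 :: "'b \<Rightarrow> 'b ordinal \<times> bool" where "polychromatic (insert UNIV \<V>) D c0"
      using polychromatic_chain by blast
    then obtain P Q where PQ: "P \<union> Q = D" "P \<inter> Q = {}"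
      and big: "\<And>X. X \<in> insert UNIV \<V> \<Longrightarrow> infinite (X \<inter> D) \<Longrightarrow>
        |X \<inter> D| \<le>o |X \<inter> P| \<and> |X \<inter> D| \<le>o |X \<inter> Q|"
      and P: "hits P (insert UNIV \<V>) D"
      by (rule split_polychromatic) (rule that)
    have Q: "|D| \<le>o |Q|"
      using big[of UNIV] False by simp
    then have "infinite Q"
      using False card_of_ordLeq_infinite by blast
    then obtain e :: "'b \<Rightarrow> 'k" where e: "\<And>Z. |Q - Z| <o |Q| \<Longrightarrow> required Q \<subseteq> e ` (Q \<inter> Z)"
      using polychromatic_cosmall by blast
    obtain c :: "'b \<Rightarrow> 'k" where c: "polychromatic \<V> P c"
      using polychromatic_chain[OF V] by blast
    define d where "d b = (if b \<in> P then c b else e b)" for b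
    have "required (X \<inter> D) \<subseteq> d ` (X \<inter> D)" if X: "X \<in> \<V>" for X
    proof -
      have "required (X \<inter> D) \<subseteq> (required (X \<inter> P) :: 'k set)"
      proof (cases "finite (X \<inter> D)")
        case True
        then show ?thesis
          using P X least_in_required[of "X \<inter> P"] by (auto simp: required_finite hits_def)
      next
        case False
        then show ?thesis
          using big[of X] X by (intro required_mono) simp
      qed
      also have "\<dots> \<subseteq> c ` (X \<inter> P)"
        using c X by (rule polychromaticD)
      also have "\<dots> = d ` (X \<inter> P)"
        by (rule image_cong) (simp_all add: d_def)
      also have "\<dots> \<subseteq> d ` (X \<inter> D)"
        using PQ(1) by blast
      finally show ?thesis .
    qed
    moreover have "required (X \<inter> D) \<subseteq> d ` (X \<inter> D)" if X: "X \<in> \<U>" for X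
    proof (cases "X \<inter> D = {}")
      case True
      then show ?thesis
        by (simp add: required_finite)
    next
      case False
      have "|Q - X| \<le>o |D - X|"
        using PQ(1) by (intro card_of_mono1) blast
      also have "|D - X| <o |D|"
        using False D(1) by (intro small X) blast
      also note Q
      finally have QX: "|Q - X| <o |Q|" .
      have "|X \<inter> D| \<le>o |D|"
        by (intro card_of_mono1) simp
      then have "|X \<inter> D| \<le>o |Q|"
        using Q by (rule ordLeq_transitive)
      then have "required (X \<inter> D) \<subseteq> (required Q :: 'k set)"
        by (rule required_mono)
      also have "\<dots> \<subseteq> e ` (Q \<inter> X)"
        using QX by (rule e)
      also have "\<dots> = d ` (Q \<inter> X)"
        using PQ(2) by (intro image_cong) (auto simp: d_def)
      also have "\<dots> \<subseteq> d ` (X \<inter> D)"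
        using PQ(1) by blast
      finally show ?thesis .
    qed
    ultimately have "polychromatic (\<U> \<union> \<V>) D d"
      unfolding polychromatic_def by blast
    then show ?thesis
      by blast
  qed
  then show thesis
    using that D by blast
qed

text \<open>A stage joins a hitting set \<open>D\<close> for \<open>\<U>\<close> and one for
  \<open>\<V>\<close> taken from \<open>A - D\<close>; each is coloured for both chains, hence so is
  the union.\<close>

lemma polychromatic_two_chains:
  fixes \<U> \<V> :: "'b set set"
  assumes U: "chain\<^sub>\<subseteq> \<U>" and V: "chain\<^sub>\<subseteq> \<V>"
  shows "\<exists>c :: 'b \<Rightarrow> 'k::wellorder. polychromatic (\<U> \<union> \<V>) B c"
proof (rule polychromatic_transfinite)
  fix A
  obtain D and c :: "'b \<Rightarrow> 'k"
    where D: "D \<subseteq> A" "hits D \<U> A" "polychromatic (\<U> \<union> \<V>) D c"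
    by (rule two_chains_hitting_set[OF U V]) (rule that)
  obtain E and d :: "'b \<Rightarrow> 'k"
    where E: "E \<subseteq> A - D" "hits E \<V> (A - D)" "polychromatic (\<V> \<union> \<U>) E d"
    by (rule two_chains_hitting_set[OF V U]) (rule that)
  have DE: "D \<union> E \<subseteq> A" "D \<inter> E = {}"
    using D(1) E(1) by blast+
  have "polychromatic (\<U> \<union> \<V>) (D \<union> E) (\<lambda>b. if b \<in> D then c b else d b)"
    using D(3) E(3) DE(2) by (intro polychromatic_Un) (simp_all add: Un_commute)
  moreover have "hits (D \<union> E) (\<U> \<union> \<V>) A"
    using D(2) E(2) unfolding hits_def by blast
  ultimately show "\<exists>S\<subseteq>A. hits S (\<U> \<union> \<V>) A \<and> (\<exists>c :: 'b \<Rightarrow> 'k. polychromatic (\<U> \<union> \<V>) S c)"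
    using DE(1) by (intro exI[of _ "D \<union> E"] conjI exI[of _ "\<lambda>b. if b \<in> D then c b else d b"])
qed

section \<open>Convex sets in a linear order\<close>

text \<open>Symmetric in the endpoints and unaffected by reversing \<open>r\<close>, so both
  directions of the order give the same components.\<close>

definition segment :: "'a rel \<Rightarrow> 'a \<Rightarrow> 'a \<Rightarrow> 'a set" where
  "segment r x y = {z. (x, z) \<in> r \<and> (z, y) \<in> r \<or> (y, z) \<in> r \<and> (z, x) \<in> r}"

lemma segment_commute: "segment r x y = segment r y x"
  by (auto simp: segment_def)

lemma segment_converse [simp]: "segment (r\<inverse>) x y = segment r x y"
  by (auto simp: segment_def)

text \<open>Members are indexed through \<open>I\<close> so that a set can occur several times.
  \<open>A\<close> stands for the members left at some stage and may leave points of
  \<open>L\<close> uncovered.\<close>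

locale convex_family =
  fixes L :: "'a set" and r :: "'a rel" and I :: "'b \<Rightarrow> 'a set" and A :: "'b set"
  assumes lin: "linear_order_on L r"
    and carrier: "b \<in> A \<Longrightarrow> I b \<subseteq> L"
    and convex: "\<lbrakk>b \<in> A; x \<in> I b; y \<in> I b; (x, z) \<in> r; (z, y) \<in> r\<rbrakk> \<Longrightarrow> z \<in> I b"
begin

text \<open>The classes are the components. \<open>linked x x\<close> holds exactly for the covered
  points \<open>x\<close>.\<close>

definition linked :: "'a \<Rightarrow> 'a \<Rightarrow> bool" where
  "linked x y \<longleftrightarrow> x \<in> L \<and> y \<in> L \<and> (\<exists>F\<subseteq>A. finite F \<and> segment r x y \<subseteq> \<Union>(I ` F))"

text \<open>\<open>P\<close> is the point-finite part and \<open>G\<close> the part with the common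
  point \<open>q\<close>; \<open>s\<close> is \<open>r\<close> or its converse, according to the
  side of \<open>p\<close>. A member that meets the component of \<open>p\<close> is confined to it
  by \<open>linked_same\<close>.\<close>

definition half_cover :: "'a rel \<Rightarrow> 'a \<Rightarrow> 'b set \<Rightarrow> 'b set \<Rightarrow> 'a \<Rightarrow> bool" where
  "half_cover s p P G q \<longleftrightarrow> P \<subseteq> A \<and> G \<subseteq> A \<and> (\<forall>b\<in>P \<union> G. \<exists>y\<in>I b. linked p y) \<and>
     (\<forall>y. linked p y \<longrightarrow> (p, y) \<in> s \<longrightarrow> (\<exists>b\<in>P \<union> G. y \<in> I b)) \<and>
     (\<forall>y. finite {b \<in> P. y \<in> I b}) \<and> (\<forall>b\<in>G. q \<in> I b)"

lemma r_trans: "(x, y) \<in> r \<Longrightarrow> (y, z) \<in> r \<Longrightarrow> (x, z) \<in> r"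
  using lin unfolding order_on_defs by (blast dest: transD)

lemma r_total: "x \<in> L \<Longrightarrow> y \<in> L \<Longrightarrow> (x, y) \<in> r \<or> (y, x) \<in> r"
  using lin unfolding order_on_defs total_on_def refl_on_def by metis

lemma linked_sym: "linked x y \<Longrightarrow> linked y x"
  unfolding linked_def by (subst segment_commute) blast

lemma linked_trans:
  assumes "linked x y" "linked y z"
  shows "linked x z"
proof -
  obtain F G where "F \<subseteq> A" "G \<subseteq> A" "finite F" "finite G"
    "segment r x y \<subseteq> \<Union>(I ` F)" "segment r y z \<subseteq> \<Union>(I ` G)"
    using assms unfolding linked_def by blast
  moreover have "segment r x z \<subseteq> segment r x y \<union> segment r y z"
  proof
    fix u assume "u \<in> segment r x z"
    moreover from this have "u \<in> L"
      using lin unfolding order_on_defs segment_def by blast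
    ultimately show "u \<in> segment r x y \<union> segment r y z"
      using r_total[of u y] assms unfolding segment_def linked_def by blast
  qed
  ultimately have "F \<union> G \<subseteq> A" "finite (F \<union> G)" "segment r x z \<subseteq> \<Union>(I ` (F \<union> G))"
    by auto
  then show ?thesis
    using assms unfolding linked_def by blast
qed

lemma linked_segment:
  assumes "linked x y" "z \<in> segment r x y"
  shows "linked x z"
proof -
  have "segment r x z \<subseteq> segment r x y"
    using assms(2) r_trans unfolding segment_def by blast
  moreover have "z \<in> L"
    using assms(2) lin unfolding order_on_defs segment_def by blast
  ultimately show ?thesis
    using assms(1) unfolding linked_def by (meson subset_trans)
qed

lemma linked_same:
  assumes "b \<in> A" "x \<in> I b" "y \<in> I b"
  shows "linked x y"
proof -
  have "segment r x y \<subseteq> I b"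
    unfolding segment_def
    using convex[OF assms(1,2,3)] convex[OF assms(1,3,2)] by blast
  moreover have "x \<in> L" "y \<in> L"
    using assms carrier[OF assms(1)] by blast+
  ultimately show ?thesis
    using assms(1) unfolding linked_def by (intro conjI exI[of _ "{b}"]) simp_all
qed

text \<open>
  Either some \<open>x\<close> sees all the way up its component, and the sets containing \<open>x\<close> do the job, or
  there is a sequence that no set meets in two consecutive points.  The latter is cofinal in the
  component because finitely many sets cannot contain all of its points.
\<close>

lemma half_cover_exists:
  assumes p: "linked p p"
  shows "\<exists>P G q. half_cover r p P G q"
proof (cases "\<exists>x. linked p x \<and> (p, x) \<in> r \<and>
    (\<forall>y. linked p y \<longrightarrow> (p, y) \<in> r \<longrightarrow> (y, x) \<in> r \<or> (\<exists>b\<in>A. x \<in> I b \<and> y \<in> I b))")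
  case True
  then obtain x where x: "linked p x" "(p, x) \<in> r"
    and sees: "\<And>y. \<lbrakk>linked p y; (p, y) \<in> r; (y, x) \<notin> r\<rbrakk> \<Longrightarrow> \<exists>b\<in>A. x \<in> I b \<and> y \<in> I b"
    by blast
  obtain F where F: "F \<subseteq> A" "finite F" "segment r p x \<subseteq> \<Union>(I ` F)"
    using x(1) unfolding linked_def by blast
  \<comment> \<open>\<open>F\<close> handles the points up to \<open>x\<close>, the members through
    \<open>x\<close> handle those beyond. Members of \<open>F\<close> that avoid the segment are
    dropped, as they could lie in other components.\<close>
  have "half_cover r p {b \<in> F. I b \<inter> segment r p x \<noteq> {}} {b \<in> A. x \<in> I b} x"
    unfolding half_cover_def
  proof (intro conjI ballI allI impI)
    fix b assume "b \<in> {b \<in> F. I b \<inter> segment r p x \<noteq> {}} \<union> {b \<in> A. x \<in> I b}"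
    then show "\<exists>y\<in>I b. linked p y"
      using linked_segment[OF x(1)] x(1) by blast
  next
    fix y assume y: "linked p y" "(p, y) \<in> r"
    show "\<exists>b\<in>{b \<in> F. I b \<inter> segment r p x \<noteq> {}} \<union> {b \<in> A. x \<in> I b}. y \<in> I b"
    proof (cases "(y, x) \<in> r")
      case True
      then have "y \<in> segment r p x"
        using y by (simp add: segment_def)
      then show ?thesis
        using F(3) by blast
    next
      case False
      then show ?thesis
        using sees[OF y] by blast
    qed
  qed (use F in auto)
  then show ?thesis
    by blast
next
  case False
  then have "\<exists>y. (linked p y \<and> (p, y) \<in> r) \<and> (y, x) \<notin> r \<and> (\<forall>b\<in>A. x \<in> I b \<longrightarrow> y \<notin> I b)"
    if "linked p x \<and> (p, x) \<in> r" for x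
    using that by blast
  moreover have "linked p p \<and> (p, p) \<in> r"
    using p r_total[of p p] by (auto simp: linked_def)
  ultimately obtain X :: "nat \<Rightarrow> 'a" where X0: "X 0 = p" and X: "\<And>n. linked p (X n) \<and> (p, X n) \<in> r"
    and step: "\<And>n. (X (Suc n), X n) \<notin> r \<and> (\<forall>b\<in>A. X n \<in> I b \<longrightarrow> X (Suc n) \<notin> I b)"
    using dependent_nat_choice[of "\<lambda>n x. linked p x \<and> (p, x) \<in> r \<and> (n = 0 \<longrightarrow> x = p)"
        "\<lambda>_ x y. (y, x) \<notin> r \<and> (\<forall>b\<in>A. x \<in> I b \<longrightarrow> y \<notin> I b)"] by (metis nat.discI)
  have XL: "X n \<in> L" for n
    using X[of n] by (simp add: linked_def)
  have Suc_le: "(X n, X (Suc n)) \<in> r" for n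
    using step[of n] r_total[OF XL[of n] XL[of "Suc n"]] by blast
  have mono: "(X n, X m) \<in> r" if "n \<le> m" for n m
    using that
  proof (induction rule: dec_induct)
    case base
    show ?case
      using r_total[OF XL XL] by blast
  next
    case (step m)
    then show ?case
      using r_trans Suc_le by blast
  qed
  \<comment> \<open>By convexity such a member would contain both \<open>X n\<close> and
    \<open>X (Suc n)\<close>.\<close>
  have gap: False if "b \<in> A" "u \<in> I b" "v \<in> I b" "(u, X n) \<in> r" "(X (Suc n), v) \<in> r" for b u v n
  proof -
    have "X n \<in> I b"
      using convex[OF that(1-4)] r_trans[OF Suc_le that(5)] by blast
    moreover have "X (Suc n) \<in> I b"
      using convex[OF that(1-3) _ that(5)] r_trans[OF that(4) Suc_le] by blast
    ultimately show False
      using step that(1) by blast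
  qed
  have seg: "(X n, u) \<in> r \<and> (u, X (Suc n)) \<in> r" if "u \<in> segment r (X n) (X (Suc n))" for n u
    using that Suc_le[of n] step[of n] r_trans unfolding segment_def by blast
  have link: "linked (X n) (X (Suc n))" for n
    using X linked_sym linked_trans by blast
  then have "\<exists>F. F \<subseteq> A \<and> finite F \<and> segment r (X n) (X (Suc n)) \<subseteq> \<Union>(I ` F)" for n
    unfolding linked_def by blast
  then obtain F where F: "\<And>n. F n \<subseteq> A" "\<And>n. finite (F n)"
    "\<And>n. segment r (X n) (X (Suc n)) \<subseteq> \<Union>(I ` F n)"
    by metis
  \<comment> \<open>Finite covers of the consecutive segments, where members avoiding their segment
    are dropped; this pruning also makes \<open>P\<close> point-finite.\<close>
  define P where "P = (\<Union>n. {b \<in> F n. I b \<inter> segment r (X n) (X (Suc n)) \<noteq> {}})"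
  have PA: "P \<subseteq> A"
    using F(1) by (auto simp: P_def)
  have "\<exists>y\<in>I b. linked p y" if b: "b \<in> P" for b
  proof -
    obtain n u where "u \<in> I b" "u \<in> segment r (X n) (X (Suc n))"
      using b by (auto simp: P_def)
    then show ?thesis
      using linked_segment[OF link] linked_trans X by blast
  qed
  moreover have "\<exists>b\<in>P. y \<in> I b" if y: "linked p y" "(p, y) \<in> r" for y
  proof -
    have "\<exists>n. (X n, y) \<notin> r"
    proof (rule ccontr)
      assume "\<not> ?thesis"
      then have in_seg: "X n \<in> segment r p y" for n
        using X by (auto simp: segment_def)
      obtain E where E: "E \<subseteq> A" "finite E" "segment r p y \<subseteq> \<Union>(I ` E)"
        using y(1) unfolding linked_def by blast
      then have "\<exists>b\<in>E. X n \<in> I b" for n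
        using in_seg[of n] by blast
      then obtain f where f: "\<And>n. f n \<in> E" "\<And>n. X n \<in> I (f n)"
        by metis
      \<comment> \<open>Pigeonhole: one of the finitely many members in \<open>E\<close> contains
        two points of the sequence, hence by convexity two consecutive ones.\<close>
      have "finite (range f)"
        using f(1) by (intro finite_subset[OF _ E(2)]) blast
      then have "\<not> inj f"
        using finite_imageD infinite_UNIV_nat by blast
      then obtain n m where nm: "n < m" "f n = f m"
        unfolding inj_def by (metis linorder_neqE_nat)
      then show False
        using gap[of "f n" "X n" "X m" n] f[of n] f(2)[of m] E(1) mono[of n n] mono[of "Suc n" m]
        by auto
    qed
    moreover have "(X n, y) \<in> r" if "\<And>k. (X k, y) \<in> r \<Longrightarrow> (X (Suc k), y) \<in> r" for n
      using that y(2) X0 by (induction n) auto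
    ultimately obtain k where k: "(X k, y) \<in> r" "(X (Suc k), y) \<notin> r"
      by metis
    have "y \<in> L"
      using y(1) by (simp add: linked_def)
    then have "(y, X (Suc k)) \<in> r"
      using r_total[OF _ XL[of "Suc k"]] k(2) by blast
    then have "y \<in> segment r (X k) (X (Suc k))"
      using k(1) by (simp add: segment_def)
    then show ?thesis
      using F(3)[of k] unfolding P_def by blast
  qed
  moreover have "finite {b \<in> P. y \<in> I b}" for y
  proof (cases "\<exists>k. (y, X k) \<in> r")
    case True
    then obtain k where k: "(y, X k) \<in> r"
      by blast
    \<comment> \<open>A member from \<open>F n\<close> with \<open>n > k\<close> reaches to
      \<open>X (Suc k)\<close> or beyond; if it also contained \<open>y\<close>, it would span the
      gap after \<open>X k\<close>.\<close>
    have "{b \<in> P. y \<in> I b} \<subseteq> (\<Union>n\<le>k. F n)"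
    proof
      fix b assume "b \<in> {b \<in> P. y \<in> I b}"
      then obtain n u where b: "b \<in> F n" "y \<in> I b" "u \<in> I b" "u \<in> segment r (X n) (X (Suc n))"
        by (auto simp: P_def)
      have "n \<le> k"
      proof (rule ccontr)
        assume "\<not> n \<le> k"
        then have "(X (Suc k), X n) \<in> r"
          by (intro mono) simp
        then have "(X (Suc k), u) \<in> r"
          using seg[OF b(4)] r_trans by blast
        then show False
          using gap[OF _ b(2,3) k] b(1) F(1) by blast
      qed
      then show "b \<in> (\<Union>n\<le>k. F n)"
        using b(1) by blast
    qed
    then show ?thesis
      using F(2) by (meson finite_UN_I finite_atMost finite_subset)
  next
    case False
    \<comment> \<open>A covered \<open>y\<close> lies beyond the whole sequence here, while a member
      that meets the segment from \<open>X n\<close> stops before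
      \<open>X (Suc (Suc n))\<close>.\<close>
    have "b \<notin> P" if y: "y \<in> I b" for b
    proof
      assume b: "b \<in> P"
      then obtain n u where u: "u \<in> I b" "u \<in> segment r (X n) (X (Suc n))"
        by (auto simp: P_def)
      have "b \<in> A"
        using b PA by blast
      then have "(X (Suc (Suc n)), y) \<in> r"
        using False r_total[OF XL] carrier y by blast
      then show False
        using gap[OF \<open>b \<in> A\<close> u(1) y] seg[OF u(2)] by blast
    qed
    then have "{b \<in> P. y \<in> I b} = {}"
      by blast
    then show ?thesis
      by (simp only: finite.emptyI)
  qed
  ultimately have "half_cover r p P {} p"
    unfolding half_cover_def using PA by simp
  then show ?thesis
    by blast
qed

section \<open>Traces of points, and subfamilies that hit them all\<close>

abbreviation traces :: "'b set set" where
  "traces \<equiv> range (\<lambda>x. {b. x \<in> I b})"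

lemma r_field: "(x, y) \<in> r \<Longrightarrow> x \<in> L \<and> y \<in> L"
  using lin unfolding order_on_defs by blast

lemma converse_family: "convex_family L (r\<inverse>) I A"
proof
  show "linear_order_on L (r\<inverse>)"
    using lin by simp
qed (use carrier convex in blast)+

text \<open>Reversal leaves \<open>linked\<close> unchanged, so the result for the side above
  \<open>p\<close> transfers to the side below.\<close>

lemma half_cover_converse_exists:
  assumes "linked p p"
  shows "\<exists>P G q. half_cover (r\<inverse>) p P G q"
proof -
  have "convex_family.linked L (r\<inverse>) I A = linked"
    by (intro ext) (simp add: convex_family.linked_def[OF converse_family] linked_def)
  then show ?thesis
    using convex_family.half_cover_exists[OF converse_family, of p] assms
    by (simp add: convex_family.half_cover_def[OF converse_family] half_cover_def)
qed

text \<open>By convexity a member of \<open>S\<close> containing a point contains everything between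
  it and \<open>q\<close>. So the traces on \<open>S\<close> shrink with the distance from
  \<open>q\<close>, and each side gives a chain.\<close>

lemma polychromatic_star:
  assumes S: "S \<subseteq> A" "\<And>b. b \<in> S \<Longrightarrow> q \<in> I b"
  shows "\<exists>c :: 'b \<Rightarrow> 'k::wellorder. polychromatic traces S c"
proof -
  let ?tr = "\<lambda>x. {b \<in> S. x \<in> I b}"
  have up: "?tr y \<subseteq> ?tr x" if "(q, x) \<in> r" "(x, y) \<in> r" for x y
  proof
    fix b assume b: "b \<in> ?tr y"
    then have "x \<in> I b"
      using S that by (intro convex[of b q y x]) auto
    then show "b \<in> ?tr x"
      using b by simp
  qed
  have down: "?tr x \<subseteq> ?tr y" if "(y, q) \<in> r" "(x, y) \<in> r" for x y
  proof
    fix b assume b: "b \<in> ?tr x"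
    then have "y \<in> I b"
      using S that by (intro convex[of b x q y]) auto
    then show "b \<in> ?tr y"
      using b by simp
  qed
  let ?U = "?tr ` {x. (q, x) \<in> r}" and ?V = "?tr ` {x. (x, q) \<in> r}"
  have "chain\<^sub>\<subseteq> ?U"
    unfolding chain_subset_def
  proof (intro ballI)
    fix X Y assume "X \<in> ?U" "Y \<in> ?U"
    then obtain x y where "X = ?tr x" "Y = ?tr y" "(q, x) \<in> r" "(q, y) \<in> r"
      by blast
    then show "X \<subseteq> Y \<or> Y \<subseteq> X"
      using up[of x y] up[of y x] r_total[of x y] r_field by metis
  qed
  moreover have "chain\<^sub>\<subseteq> ?V"
    unfolding chain_subset_def
  proof (intro ballI)
    fix X Y assume "X \<in> ?V" "Y \<in> ?V"
    then obtain x y where "X = ?tr x" "Y = ?tr y" "(x, q) \<in> r" "(y, q) \<in> r"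
      by blast
    then show "X \<subseteq> Y \<or> Y \<subseteq> X"
      using down[of x y] down[of y x] r_total[of x y] r_field by metis
  qed
  ultimately obtain c :: "'b \<Rightarrow> 'k" where c: "polychromatic (?U \<union> ?V) S c"
    using polychromatic_two_chains by blast
  have "required ({b. x \<in> I b} \<inter> S) \<subseteq> c ` ({b. x \<in> I b} \<inter> S)" for x
  proof (cases "{b. x \<in> I b} \<inter> S = {}")
    case True
    then show ?thesis
      by (simp add: required_finite)
  next
    case False
    then obtain b where "b \<in> S" "x \<in> I b"
      by blast
    then have "x \<in> L" "q \<in> L"
      using S carrier[of b] by auto
    then have "?tr x \<in> ?U \<union> ?V"
      using r_total[of x q] by blast
    then have "required (?tr x \<inter> S) \<subseteq> c ` (?tr x \<inter> S)"
      by (rule polychromaticD[OF c])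
    moreover have "?tr x \<inter> S = {b. x \<in> I b} \<inter> S"
      by blast
    ultimately show ?thesis
      by simp
  qed
  then have "polychromatic traces S c"
    by (simp add: polychromatic_def)
  then show ?thesis
    by blast
qed

text \<open>Fix a base point in every component and combine the half covers of both sides: the
  point-finite parts form \<open>P\<close>, the stars above and below form \<open>G\<close> and
  \<open>H\<close>.\<close>

lemma hitting_subfamily:
  "\<exists>S\<subseteq>A. hits S traces A \<and> (\<exists>c :: 'b \<Rightarrow> 'k::wellorder. polychromatic traces S c)"
proof -
  \<comment> \<open>The choice depends only on the predicate \<open>linked x\<close>, which is the
    same throughout a component.\<close>
  define rep where "rep x = (SOME p. linked x p)" for x
  have rep: "linked x (rep x)" if "linked x x" for x
    unfolding rep_def using that by (rule someI)
  have rep_eq: "rep x = rep y" if "linked x y" for x y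
  proof -
    have "linked x = linked y"
      using that linked_trans linked_sym by blast
    then show ?thesis
      by (simp add: rep_def)
  qed
  define K where "K = {p. linked p p \<and> rep p = p}"
  have "\<exists>P G q. linked p p \<longrightarrow> half_cover r p P G q" "\<exists>P G q. linked p p \<longrightarrow> half_cover (r\<inverse>) p P G q" for p
    using half_cover_exists half_cover_converse_exists by blast+
  then obtain PR GR qR PL GL qL
    where "\<And>p. linked p p \<longrightarrow> half_cover r p (PR p) (GR p) (qR p)"
      and "\<And>p. linked p p \<longrightarrow> half_cover (r\<inverse>) p (PL p) (GL p) (qL p)"
    by metis
  then have right: "half_cover r p (PR p) (GR p) (qR p)"
    and left: "half_cover (r\<inverse>) p (PL p) (GL p) (qL p)" if "p \<in> K" for p
    using that by (auto simp: K_def)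
  have sub: "PR p \<subseteq> A" "GR p \<subseteq> A" "PL p \<subseteq> A" "GL p \<subseteq> A" if "p \<in> K" for p
    using right[OF that] left[OF that] by (auto simp: half_cover_def)
  have comp: "rep x = p" if p: "p \<in> K" and b: "b \<in> PR p \<union> GR p \<union> PL p \<union> GL p" and x: "x \<in> I b" for p b x
  proof -
    obtain y where y: "y \<in> I b" "linked p y"
      using right[OF p] left[OF p] b unfolding half_cover_def by blast
    have "b \<in> A"
      using sub[OF p] b by blast
    then have "linked p x"
      using y linked_same[OF _ y(1) x] linked_trans by blast
    then have "rep p = rep x"
      by (rule rep_eq)
    then show ?thesis
      using p by (simp add: K_def)
  qed
  define P where "P = (\<Union>p\<in>K. PR p \<union> PL p)"
  \<comment> \<open>The differences make \<open>P\<close>, \<open>G\<close> and \<open>H\<close>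
    disjoint, as \<open>polychromatic_Un\<close> demands.\<close>
  define G where "G = (\<Union>p\<in>K. GR p) - P"
  define H where "H = (\<Union>p\<in>K. GL p) - P - G"
  have "P \<subseteq> A" "(\<Union>p\<in>K. GR p) \<subseteq> A" "(\<Union>p\<in>K. GL p) \<subseteq> A"
    unfolding P_def by (intro UN_least Un_least sub; assumption)+
  then have SA: "P \<union> (G \<union> H) \<subseteq> A"
    unfolding G_def H_def by (intro Un_least subset_trans[OF Diff_subset])
  have hit: "hits (P \<union> (G \<union> H)) traces A"
    unfolding hits_def
  proof (intro ballI impI)
    fix X assume "X \<in> traces" and XA: "X \<inter> A \<noteq> {}"
    then obtain x where X: "X = {b. x \<in> I b}"
      by blast
    then obtain b where "b \<in> A" "x \<in> I b"
      using XA by blast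
    then have "linked x x"
      using linked_same by blast
    then have xp: "linked x (rep x)"
      by (rule rep)
    define p where "p = rep x"
    have px: "linked p x"
      using xp linked_sym by (simp add: p_def)
    then have p: "p \<in> K"
      using rep_eq[OF px] linked_trans[OF px linked_sym[OF px]] by (simp add: K_def p_def)
    have "(p, x) \<in> r \<or> (p, x) \<in> r\<inverse>"
      using px r_total[of p x] by (auto simp: linked_def)
    then have "\<exists>b\<in>PR p \<union> GR p \<union> (PL p \<union> GL p). x \<in> I b"
      using right[OF p] left[OF p] px unfolding half_cover_def by blast
    then obtain b where b: "b \<in> PR p \<union> GR p \<union> (PL p \<union> GL p)" "x \<in> I b"
      by (rule bexE)
    then have "b \<in> P \<union> (G \<union> H)"
      using p by (auto simp: P_def G_def H_def)
    then show "X \<inter> (P \<union> (G \<union> H)) \<noteq> {}"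
      using b(2) X by auto
  qed
  \<comment> \<open>Only the component of a point contributes members containing it, finitely many
    from each of its two sides.\<close>
  have "finite (X \<inter> P)" if traceX: "X \<in> traces" for X
  proof -
    obtain x where X: "X = {b. x \<in> I b}"
      using traceX by blast
    show ?thesis
    proof (cases "rep x \<in> K")
      case True
      have "X \<inter> P \<subseteq> {b \<in> PR (rep x). x \<in> I b} \<union> {b \<in> PL (rep x). x \<in> I b}"
        using comp by (auto simp: X P_def)
      moreover have "finite ({b \<in> PR (rep x). x \<in> I b} \<union> {b \<in> PL (rep x). x \<in> I b})"
        using right[OF True] left[OF True] by (simp add: half_cover_def)
      ultimately show ?thesis
        by (rule finite_subset)
    next
      case False
      then have "X \<inter> P = {}"
        using comp by (auto simp: X P_def)
      then show ?thesis
        by (simp only: finite.emptyI)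
    qed
  qed
  then have P: "polychromatic traces P (\<lambda>_. least :: 'k)"
    by (rule polychromatic_pointwise_finite)
  define \<pi> where "\<pi> b = rep (SOME x. x \<in> I b)" for b
  have \<pi>: "rep x = \<pi> b" if "b \<in> A" "x \<in> I b" for b x
    unfolding \<pi>_def using that by (intro rep_eq linked_same[of b] someI[of "\<lambda>x. x \<in> I b"])
  \<comment> \<open>Within one component the members of \<open>S\<close> share a point and form a
    star; every trace stays in one component, so the stars glue.\<close>
  have glue: "\<exists>c :: 'b \<Rightarrow> 'k. polychromatic traces S c"
    if S: "S \<subseteq> A" and q: "\<And>b. b \<in> S \<Longrightarrow> q (\<pi> b) \<in> I b" for S and q :: "'a \<Rightarrow> 'a"
  proof -
    have star: "\<forall>p. \<exists>c :: 'b \<Rightarrow> 'k. polychromatic traces {b \<in> S. \<pi> b = p} c"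
      using S q by (intro allI polychromatic_star[of _ "q p" for p]) auto
    obtain c :: "'a \<Rightarrow> 'b \<Rightarrow> 'k" where c: "\<forall>p. polychromatic traces {b \<in> S. \<pi> b = p} (c p)"
      using choice[OF star] by (rule exE)
    have "\<exists>p. \<forall>b\<in>X \<inter> S. \<pi> b = p" if X: "X \<in> traces" for X
    proof -
      obtain x where "X = {b. x \<in> I b}"
        using X by blast
      then show ?thesis
        using \<pi> S by (intro exI[of _ "rep x"]) auto
    qed
    with c[rule_format] have "polychromatic traces S (\<lambda>b. c (\<pi> b) b)"
      by (rule polychromatic_glue)
    then show ?thesis
      by blast
  qed
  have clump: "\<pi> b = p" if "p \<in> K" "b \<in> PR p \<union> GR p \<union> PL p \<union> GL p" "x \<in> I b" for p b x
  proof -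
    have "b \<in> A"
      using sub[OF that(1)] that(2) by blast
    then show ?thesis
      using comp[OF that] \<pi>[of b x] that(3) by simp
  qed
  have "qR (\<pi> b) \<in> I b" if b: "b \<in> G" for b
  proof -
    obtain p where p: "p \<in> K" "b \<in> GR p"
      using b by (auto simp: G_def)
    then have q: "qR p \<in> I b"
      using right[OF p(1)] by (simp add: half_cover_def)
    then show ?thesis
      using clump[OF p(1) _ q] p(2) q by simp
  qed
  then obtain c :: "'b \<Rightarrow> 'k" where c: "polychromatic traces G c"
    using glue[of G qR] SA by auto
  have "qL (\<pi> b) \<in> I b" if b: "b \<in> H" for b
  proof -
    obtain p where p: "p \<in> K" "b \<in> GL p"
      using b by (auto simp: H_def)
    then have q: "qL p \<in> I b"
      using left[OF p(1)] by (simp add: half_cover_def)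
    then show ?thesis
      using clump[OF p(1) _ q] p(2) q by simp
  qed
  then obtain d :: "'b \<Rightarrow> 'k" where d: "polychromatic traces H d"
    using glue[of H qL] SA by auto
  have "G \<inter> H = {}" "P \<inter> (G \<union> H) = {}"
    by (auto simp: G_def H_def)
  then have "polychromatic traces (P \<union> (G \<union> H))
      (\<lambda>b. if b \<in> P then least else if b \<in> G then c b else d b)"
    using P c d by (intro polychromatic_Un)
  then show ?thesis
    using SA hit by (intro exI[of _ "P \<union> (G \<union> H)"] conjI exI)
qed

end

section \<open>From hitting subfamilies to a maximally good colouring\<close>

lemma convex_family_polychromatic:
  assumes "convex_family L r I B"
  shows "\<exists>c :: 'b \<Rightarrow> 'k::wellorder. polychromatic (range (\<lambda>x. {b. x \<in> I b})) B c"
proof (rule polychromatic_transfinite)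
  fix A assume "A \<subseteq> B"
  then have "convex_family L r I A"
    using assms unfolding convex_family_def by (meson subsetD)
  then show "\<exists>S\<subseteq>A. hits S (range (\<lambda>x. {b. x \<in> I b})) A \<and>
      (\<exists>c :: 'b \<Rightarrow> 'k. polychromatic (range (\<lambda>x. {b. x \<in> I b})) S c)"
    by (rule convex_family.hitting_subfamily)
qed

theorem theorem5p1:
  fixes L :: "'a set" and r :: "'a rel"
    and \<H> :: "'a set set" and m :: "'a set \<Rightarrow> 'o ordinal"
  assumes "linear_order_on L r"
    and "\<H> \<subseteq> conv L r"
    and "\<forall>H\<in>\<H>. m H \<noteq> 0"
    and "covers (multicover \<H> m) L"
  shows "\<exists>c. maximally_good_coloring \<H> m c"
proof -
  let ?B = "multicover \<H> m"
  have field: "z \<in> L" if "(x, z) \<in> r" for x z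
    using that assms(1) unfolding order_on_defs by blast
  \<comment> \<open>Indexing by pairs turns multiplicity into repetition of the set
    \<open>fst b\<close>.\<close>
  have "convex_family L r fst ?B"
  proof
    show "linear_order_on L r"
      by (fact assms(1))
  next
    fix b assume b: "b \<in> ?B"
    then have conv: "fst b \<in> conv L r"
      using assms(2) by (auto simp: multicover_def)
    then show "fst b \<subseteq> L"
      by (simp add: conv_def)
    show "z \<in> fst b" if "x \<in> fst b" "y \<in> fst b" "(x, z) \<in> r" "(z, y) \<in> r" for x y z
      using conv that field[OF that(3)] unfolding conv_def by blast
  qed
  then obtain c :: "'a set \<times> 'o ordinal \<Rightarrow> ('a set \<times> 'o ordinal) ordinal"
    where c: "polychromatic (range (\<lambda>x. {b. x \<in> fst b})) ?B c"
    using convex_family_polychromatic by blast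
  have seen: "required (at_point ?B x) \<subseteq> c ` at_point ?B x" for x
  proof -
    have "at_point ?B x = {b. x \<in> fst b} \<inter> ?B"
      by (auto simp: at_point_def)
    then show ?thesis
      using polychromaticD[OF c, of "{b. x \<in> fst b}"] by simp
  qed
  define d where "d b = (if b \<in> ?B then Some (c b) else None)" for b
  have colors: "colors d (at_point ?B x) = c ` at_point ?B x" for x
    by (force simp: colors_def d_def dom_def at_point_def)
  have "good 1 (\<Union>\<H>) ?B d"
    unfolding good_def
  proof (intro ballI impI)
    fix x assume "|{..<1 :: ('a set \<times> 'o ordinal) ordinal}| \<le>o |at_point ?B x|"
    then have ne: "at_point ?B x \<noteq> {}"
      using card_of_empty3 by (force simp: lessThan_one_ordinal)
    \<comment> \<open>A covered point is known to see \<open>least\<close>; this is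
      \<open>0\<close>, because nothing lies below the sole predecessor of \<open>1\<close>.\<close>
    have zero: "(0 :: ('a set \<times> 'o ordinal) ordinal) = least"
    proof -
      have "{..<0 :: ('a set \<times> 'o ordinal) ordinal} = {}"
        using lessThan_one_ordinal by (metis lessThan_iff empty_iff insert_iff less_trans less_irrefl equals0I)
      then show ?thesis
        by simp
    qed
    show "{..<1} \<subseteq> colors d (at_point ?B x)"
      using subsetD[OF seen least_in_required[OF ne]] by (simp add: lessThan_one_ordinal colors zero)
  qed
  moreover have "good \<kappa> (\<Union>\<H>) ?B d" if \<kappa>: "is_cardinal \<kappa>" "infinite {..<\<kappa>}" for \<kappa>
    unfolding good_def
  proof (intro ballI impI)
    fix x assume le: "|{..<\<kappa>}| \<le>o |at_point ?B x|"
    then have "infinite (at_point ?B x)"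
      using \<kappa>(2) card_of_ordLeq_infinite by blast
    \<comment> \<open>As \<open>\<kappa>\<close> is an initial ordinal, each
      \<open>a < \<kappa>\<close> has fewer than \<open>|{..<\<kappa>}|\<close> predecessors and so
      is required.\<close>
    then have "{..<\<kappa>} \<subseteq> required (at_point ?B x)"
      using \<kappa>(1) le unfolding is_cardinal_def
      by (auto simp: required_infinite intro: ordLess_ordLeq_trans)
    then show "{..<\<kappa>} \<subseteq> colors d (at_point ?B x)"
      using seen[of x] by (simp add: colors)
  qed
  ultimately have "maximally_good_coloring \<H> m d"
    unfolding maximally_good_coloring_def by (auto simp: d_def dom_def split: if_splits)
  then show ?thesis
    by blast
qed

end
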